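(* Let $u_0\in H^1(\Omega)$, $v_0\in H^1_0(\Omega)$, $h>0$, $u_1:=u_0+hv_0$, and for each integer $m\ge 2$ let $u_m$ be, iteratively, a minimizer over $\mathcal K$ of the functional $$I_m(u) := \int_{\Omega}\frac{|u -2u_{m-1} +u_{m-2}|^2}{2 h^2} \,dx + \frac{1}{4} \int_{\Omega} |\nabla u + \nabla u_{m-2}|^2 \,dx .$$ Then the minimizers conserve the energy $$E_k := \Bigl\|\frac{u_k -u_{k-1}}{h} \Bigr\|^2_{L^2(\Omega)} + \frac{1}{2}\Bigl( \|\nabla u_k\|^2_{L^2(\Omega)} +\|\nabla u_{k-1}\|^2_{L^2(\Omega)} \Bigr),$$ in the sense that $E_k$ is independent of $k\ge 1$.
   Context: $\Omega\subset\mathbb R^N$ is a bounded Lipschitz domain, and $\mathcal K:=\{u\in H^1(\Omega)\,:\,u=u_0 \text{ on }\partial\Omega\}$ (equality in the sense of traces). Note $u_0,u_1\in\mathcal K$. Functions are real valued. *)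

theory Defs
  imports "HOL-Analysis.Analysis"
begin

text \<open>Elements of \<open>L\<^sup>2(\<Omega>)\<close> and \<open>H\<^sup>1(\<Omega>)\<close> are represented by functions on the whole space, of which
  only the values on \<open>\<Omega>\<close> up to null sets matter.\<close>

definition L2 :: "'a measure \<Rightarrow> ('a \<Rightarrow> 'b::euclidean_space) set" where
  "L2 M = {f \<in> borel_measurable M. integrable M (\<lambda>x. (norm (f x))\<^sup>2)}"

definition L2_norm :: "'a measure \<Rightarrow> ('a \<Rightarrow> 'b::euclidean_space) \<Rightarrow> real" where
  "L2_norm M f = sqrt (LINT x|M. (norm (f x))\<^sup>2)"

definition L2_tendsto ::
    "'a measure \<Rightarrow> (nat \<Rightarrow> 'a \<Rightarrow> 'b::euclidean_space) \<Rightarrow> ('a \<Rightarrow> 'b) \<Rightarrow> bool" where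
  "L2_tendsto M f g \<longleftrightarrow> (\<forall>n. f n \<in> L2 M) \<and> g \<in> L2 M \<and>
     (\<lambda>n. L2_norm M (\<lambda>x. f n x - g x)) \<longlonglongrightarrow> 0"

definition partial :: "'a::euclidean_space \<Rightarrow> ('a \<Rightarrow> real) \<Rightarrow> 'a \<Rightarrow> real" where
  "partial i f x = frechet_derivative f (at x) i"

primrec Ck :: "nat \<Rightarrow> ('a::euclidean_space \<Rightarrow> real) \<Rightarrow> bool" where
  "Ck 0 f \<longleftrightarrow> continuous_on UNIV f"
| "Ck (Suc k) f \<longleftrightarrow> (\<forall>x. f differentiable (at x)) \<and> (\<forall>i\<in>Basis. Ck k (partial i f))"

definition smooth :: "('a::euclidean_space \<Rightarrow> real) \<Rightarrow> bool" where
  "smooth f \<longleftrightarrow> (\<forall>k. Ck k f)"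

definition test_functions :: "'a::euclidean_space set \<Rightarrow> ('a \<Rightarrow> real) set" where
  "test_functions \<Omega> = {\<phi>. smooth \<phi> \<and> compact (closure {x. \<phi> x \<noteq> 0}) \<and> closure {x. \<phi> x \<noteq> 0} \<subseteq> \<Omega>}"

definition has_weak_gradient ::
    "'a::euclidean_space set \<Rightarrow> ('a \<Rightarrow> real) \<Rightarrow> ('a \<Rightarrow> 'a) \<Rightarrow> bool" where
  "has_weak_gradient \<Omega> u g \<longleftrightarrow> (\<forall>\<phi>\<in>test_functions \<Omega>. \<forall>i\<in>Basis.
     (LINT x|lebesgue_on \<Omega>. u x * partial i \<phi> x) = - (LINT x|lebesgue_on \<Omega>. (g x \<bullet> i) * \<phi> x))"

definition H1 :: "'a::euclidean_space set \<Rightarrow> ('a \<Rightarrow> real) set" where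
  "H1 \<Omega> = {u \<in> L2 (lebesgue_on \<Omega>). \<exists>g \<in> L2 (lebesgue_on \<Omega>). has_weak_gradient \<Omega> u g}"

text \<open>The weak gradient is unique up to null sets (for open \<open>\<Omega>\<close>), so this picks a representative.\<close>

definition grad :: "'a::euclidean_space set \<Rightarrow> ('a \<Rightarrow> real) \<Rightarrow> 'a \<Rightarrow> 'a" where
  "grad \<Omega> u = (SOME g. g \<in> L2 (lebesgue_on \<Omega>) \<and> has_weak_gradient \<Omega> u g)"

definition H1_norm :: "'a::euclidean_space set \<Rightarrow> ('a \<Rightarrow> real) \<Rightarrow> real" where
  "H1_norm \<Omega> u = sqrt ((L2_norm (lebesgue_on \<Omega>) u)\<^sup>2 + (L2_norm (lebesgue_on \<Omega>) (grad \<Omega> u))\<^sup>2)"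

definition H1_tendsto ::
    "'a::euclidean_space set \<Rightarrow> (nat \<Rightarrow> 'a \<Rightarrow> real) \<Rightarrow> ('a \<Rightarrow> real) \<Rightarrow> bool" where
  "H1_tendsto \<Omega> f u \<longleftrightarrow> (\<forall>n. f n \<in> H1 \<Omega>) \<and> u \<in> H1 \<Omega> \<and>
     (\<lambda>n. H1_norm \<Omega> (\<lambda>x. f n x - u x)) \<longlonglongrightarrow> 0"

definition H1_0 :: "'a::euclidean_space set \<Rightarrow> ('a \<Rightarrow> real) set" where
  "H1_0 \<Omega> = {v. \<exists>\<phi>. (\<forall>n. \<phi> n \<in> test_functions \<Omega>) \<and> H1_tendsto \<Omega> \<phi> v}"

text \<open>Hausdorff measure of integer dimension \<open>s\<close>, normalised to agree with \<open>s\<close>-dimensional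
  volume. Empty covering sets contribute nothing, also for \<open>s = 0\<close>; boundedness is required
  because \<^const>\<open>diameter\<close> is meaningful for bounded sets only.\<close>

definition hausdorff_premeasure :: "nat \<Rightarrow> real \<Rightarrow> 'a::euclidean_space set \<Rightarrow> ennreal" where
  "hausdorff_premeasure s \<delta> A =
     (INF C \<in> {C :: nat \<Rightarrow> 'a set. A \<subseteq> (\<Union>i. C i) \<and> (\<forall>i. bounded (C i) \<and> diameter (C i) \<le> \<delta>)}.
        \<Sum>i. if C i = {} then 0 else ennreal (unit_ball_vol (real s) * (diameter (C i) / 2) ^ s))"

definition hausdorff_outer_measure :: "nat \<Rightarrow> 'a::euclidean_space set \<Rightarrow> ennreal" where
  "hausdorff_outer_measure s A = (SUP \<delta>\<in>{0<..}. hausdorff_premeasure s \<delta> A)"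

text \<open>The outer measure is countably additive on Borel sets (it is a metric outer measure), so
  \<^const>\<open>measure_of\<close> restricts it to the Borel sets.\<close>

definition hausdorff_measure :: "nat \<Rightarrow> 'a::euclidean_space measure" where
  "hausdorff_measure s = measure_of UNIV (sets borel) (hausdorff_outer_measure s)"

definition surface_measure :: "'a::euclidean_space set \<Rightarrow> 'a measure" where
  "surface_measure \<Omega> = restrict_space (hausdorff_measure (DIM('a) - 1)) (frontier \<Omega>)"

text \<open>\<open>\<Omega>\<close> lies locally on one side of the graph of a Lipschitz function defined on the hyperplane
  orthogonal to some unit vector \<open>\<nu>\<close>.\<close>

definition bounded_lipschitz_domain :: "'a::euclidean_space set \<Rightarrow> bool" where
  "bounded_lipschitz_domain \<Omega> \<longleftrightarrow> open \<Omega> \<and> connected \<Omega> \<and> \<Omega> \<noteq> {} \<and> bounded \<Omega> \<and>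
     (\<forall>p\<in>frontier \<Omega>. \<exists>r>0. \<exists>\<nu> L. \<exists>\<gamma> :: 'a \<Rightarrow> real. norm \<nu> = 1 \<and> L-lipschitz_on {y. y \<bullet> \<nu> = 0} \<gamma> \<and>
        (\<forall>x\<in>ball p r. x \<in> \<Omega> \<longleftrightarrow> \<gamma> (x - (x \<bullet> \<nu>) *\<^sub>R \<nu>) < x \<bullet> \<nu>))"

text \<open>The trace operator from \<open>H\<^sup>1(\<Omega>)\<close> to \<open>L\<^sup>2(\<partial>\<Omega>)\<close> is the continuous extension of the restriction
  \<open>\<phi> \<mapsto> \<phi>|\<partial>\<Omega>\<close>, \<open>\<phi>\<close> smooth up to the boundary. On a bounded Lipschitz domain
  \<open>has_trace\<close> is its graph.\<close>

definition has_trace ::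
    "'a::euclidean_space set \<Rightarrow> ('a \<Rightarrow> real) \<Rightarrow> ('a \<Rightarrow> real) \<Rightarrow> bool" where
  "has_trace \<Omega> u g \<longleftrightarrow>
     (\<exists>\<phi>. (\<forall>n. smooth (\<phi> n)) \<and> H1_tendsto \<Omega> \<phi> u \<and> L2_tendsto (surface_measure \<Omega>) \<phi> g)"

text \<open>Since the trace operator is linear, two functions have equal traces iff their difference has
  trace zero.\<close>

definition eq_in_trace ::
    "'a::euclidean_space set \<Rightarrow> ('a \<Rightarrow> real) \<Rightarrow> ('a \<Rightarrow> real) \<Rightarrow> bool" where
  "eq_in_trace \<Omega> u w \<longleftrightarrow> has_trace \<Omega> (\<lambda>x. u x - w x) (\<lambda>x. 0)"

definition admissible :: "'a::euclidean_space set \<Rightarrow> ('a \<Rightarrow> real) \<Rightarrow> ('a \<Rightarrow> real) set" where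
  "admissible \<Omega> u0 = {u \<in> H1 \<Omega>. eq_in_trace \<Omega> u u0}"

text \<open>\<open>p\<close> and \<open>q\<close> are the previous iterates \<open>u\<^sub>m\<^sub>-\<^sub>1\<close> and \<open>u\<^sub>m\<^sub>-\<^sub>2\<close>.\<close>

definition step_functional ::
    "'a::euclidean_space set \<Rightarrow> real \<Rightarrow> ('a \<Rightarrow> real) \<Rightarrow> ('a \<Rightarrow> real) \<Rightarrow> ('a \<Rightarrow> real) \<Rightarrow> real" where
  "step_functional \<Omega> h p q u =
     (LINT x|lebesgue_on \<Omega>. \<bar>u x - 2 * p x + q x\<bar>\<^sup>2 / (2 * h\<^sup>2)) +
     1 / 4 * (LINT x|lebesgue_on \<Omega>. (norm (grad \<Omega> u x + grad \<Omega> q x))\<^sup>2)"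

definition energy ::
    "'a::euclidean_space set \<Rightarrow> real \<Rightarrow> (nat \<Rightarrow> 'a \<Rightarrow> real) \<Rightarrow> nat \<Rightarrow> real" where
  "energy \<Omega> h u k =
     (L2_norm (lebesgue_on \<Omega>) (\<lambda>x. (u k x - u (k - 1) x) / h))\<^sup>2 +
     1 / 2 * ((L2_norm (lebesgue_on \<Omega>) (grad \<Omega> (u k)))\<^sup>2 +
              (L2_norm (lebesgue_on \<Omega>) (grad \<Omega> (u (k - 1))))\<^sup>2)"

end

theory Submission
  imports Defs
begin

text \<open>The admissible functions form an affine space containing \<open>u\<^sub>m\<close> and \<open>u\<^sub>m\<^sub>-\<^sub>2\<close>, so the first
  variation of \<open>I\<^sub>m\<close> at \<open>u\<^sub>m\<close> vanishes in the direction \<open>u\<^sub>m - u\<^sub>m\<^sub>-\<^sub>2\<close>. Since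
  \<open>u\<^sub>m - 2 u\<^sub>m\<^sub>-\<^sub>1 + u\<^sub>m\<^sub>-\<^sub>2\<close> and \<open>u\<^sub>m - u\<^sub>m\<^sub>-\<^sub>2\<close> are the difference and the sum of
  \<open>u\<^sub>m - u\<^sub>m\<^sub>-\<^sub>1\<close> and \<open>u\<^sub>m\<^sub>-\<^sub>1 - u\<^sub>m\<^sub>-\<^sub>2\<close>, and similarly for the gradients, every inner product in it is
  a difference of squares and the equation reads \<open>E\<^sub>m = E\<^sub>m\<^sub>-\<^sub>1\<close>. Linearity of the (chosen) weak
  gradient up to null sets rests on the fundamental lemma of the calculus of variations, obtained
  from smooth bump functions that converge to the indicators of boxes.\<close>

section \<open>Smooth functions\<close>

lemma Ck_continuous: "Ck k f \<Longrightarrow> continuous_on UNIV f"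
  by (cases k) (auto simp: continuous_on_eq_continuous_at intro: differentiable_imp_continuous_within)

text \<open>Serves the product rule, whose terms contain undifferentiated factors: these have class
  k + 1 but must be used as functions of class k.\<close>

lemma Ck_SucD: "Ck (Suc k) f \<Longrightarrow> Ck k f"
proof (induction k arbitrary: f)
  case 0
  then show ?case using Ck_continuous[of "Suc 0" f] by simp
next
  case (Suc k)
  then show ?case by auto
qed

lemma Ck_const: "Ck k (\<lambda>x. c)"
proof (induction k arbitrary: c)
  case (Suc k)
  have "partial i (\<lambda>x::'a. c) = (\<lambda>x. 0)" for i
    by (simp add: fun_eq_iff partial_def)
  then show ?case using Suc by simp
qed simp

lemma partial_eqI: "(f has_derivative f') (at x) \<Longrightarrow> partial i f x = f' i"
  unfolding partial_def using frechet_derivative_at by metis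

lemma partial_add:
  assumes "f differentiable (at x)" "g differentiable (at x)"
  shows "partial i (\<lambda>x. f x + g x) x = partial i f x + partial i g x"
  using has_derivative_add[OF assms[unfolded frechet_derivative_works]]
  by (simp add: partial_eqI) (simp add: partial_def)

lemma partial_mult:
  assumes "f differentiable (at x)" "g differentiable (at x)"
  shows "partial i (\<lambda>x. f x * g x) x = f x * partial i g x + partial i f x * g x"
  using has_derivative_mult[OF assms[unfolded frechet_derivative_works]]
  by (simp add: partial_eqI) (simp add: partial_def)

lemma Ck_add: "Ck k f \<Longrightarrow> Ck k g \<Longrightarrow> Ck k (\<lambda>x. f x + g x)"
proof (induction k arbitrary: f g)
  case 0
  then show ?case by (auto intro: continuous_on_add)
next
  case (Suc k)
  then have "partial i (\<lambda>x. f x + g x) = (\<lambda>x. partial i f x + partial i g x)" for i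
    by (auto simp: partial_add)
  then show ?case using Suc by auto
qed

lemma Ck_mult: "Ck k f \<Longrightarrow> Ck k g \<Longrightarrow> Ck k (\<lambda>x. f x * g x)"
proof (induction k arbitrary: f g)
  case 0
  then show ?case by (auto intro: continuous_on_mult)
next
  case (Suc k)
  then have "partial i (\<lambda>x. f x * g x) = (\<lambda>x. f x * partial i g x + partial i f x * g x)" for i
    by (auto simp: partial_mult)
  moreover have "Ck k f" "Ck k g"
    using Suc.prems Ck_SucD by blast+
  ultimately show ?case using Suc by (auto intro!: Ck_add)
qed

lemma smooth_const: "smooth (\<lambda>x. c)"
  by (simp add: smooth_def Ck_const)

lemma smooth_add: "smooth f \<Longrightarrow> smooth g \<Longrightarrow> smooth (\<lambda>x. f x + g x)"
  by (simp add: smooth_def Ck_add)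

lemma smooth_mult: "smooth f \<Longrightarrow> smooth g \<Longrightarrow> smooth (\<lambda>x. f x * g x)"
  by (simp add: smooth_def Ck_mult)

lemma smooth_prod: "(\<And>i. i \<in> I \<Longrightarrow> smooth (f i)) \<Longrightarrow> smooth (\<lambda>x. \<Prod>i\<in>I. f i x)"
  by (induction I rule: infinite_finite_induct) (auto intro: smooth_const smooth_mult)

lemma smooth_continuous: "smooth f \<Longrightarrow> continuous_on UNIV f"
  using smooth_def Ck_continuous by blast

lemma smooth_partial_continuous: "smooth f \<Longrightarrow> i \<in> Basis \<Longrightarrow> continuous_on UNIV (partial i f)"
  unfolding smooth_def by (metis Ck.simps)

section \<open>Bump functions\<close>

text \<open>The polynomial factor makes the family closed under differentiation, so that one
  induction proves smoothness. The case \<open>p = 1\<close> is the classical exp (-1/x), extended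
  by zero.\<close>

definition flat :: "real poly \<Rightarrow> real \<Rightarrow> real" where
  "flat p x = (if x \<le> 0 then 0 else poly p (1 / x) * exp (- (1 / x)))"

lemma poly_times_exp_tendsto_0: "((\<lambda>z. poly p z * exp (- z)) \<longlongrightarrow> 0) (at_top :: real filter)"
proof -
  have "((\<lambda>z. \<Sum>i\<le>degree p. coeff p i * (z ^ i / exp z)) \<longlongrightarrow> (\<Sum>i\<le>degree p. coeff p i * 0)) at_top"
    by (intro tendsto_intros tendsto_power_div_exp_0)
  then show ?thesis
    by (simp add: poly_altdef sum_distrib_right exp_minus divide_inverse mult.assoc)
qed

lemma flat_tendsto_0: "(flat p \<longlongrightarrow> 0) (at 0)"
proof -
  have "((\<lambda>x. poly p (inverse x) * exp (- inverse x)) \<longlongrightarrow> 0) (at_right 0)"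
    using filterlim_compose[OF poly_times_exp_tendsto_0 filterlim_inverse_at_top_right] .
  then have "(flat p \<longlongrightarrow> 0) (at_right 0)"
    by (rule Lim_transform_eventually)
      (auto simp: eventually_at_right_field flat_def inverse_eq_divide intro!: exI[of _ 1])
  moreover have "(flat p \<longlongrightarrow> 0) (at_left 0)"
    by (rule Lim_transform_eventually[OF tendsto_const])
      (auto simp: eventually_at_left_field flat_def intro!: exI[of _ "-1"])
  ultimately show ?thesis
    by (simp add: filterlim_split_at)
qed

text \<open>For x > 0 put z = 1/x. Since dz/dx = - z^2, the derivative of p(z) exp(-z) is z^2 (p(z)
  - p'(z)) exp(-z), again of the form \<open>flat\<close>.\<close>

lemma flat_deriv: "(flat p has_real_derivative flat (monom 1 2 * (p - pderiv p)) x) (at x)"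
proof -
  consider "x < 0" | "x = 0" | "x > 0" by linarith
  then show ?thesis
  proof cases
    case 1
    have "((\<lambda>x. 0) has_real_derivative 0) (at x)" by simp
    then have "(flat p has_real_derivative 0) (at x)"
      by (rule DERIV_cong_ev[THEN iffD1, rotated 3])
        (use 1 in \<open>auto simp: flat_def eventually_at_topological intro!: eventually_nhds[THEN iffD2] exI[of _ "{..<0}"]\<close>)
    then show ?thesis using 1 by (simp add: flat_def)
  next
    case 2
    \<comment> \<open>Dividing by y multiplies the polynomial in 1/y by its variable, so the
      difference quotient at 0 is \<open>flat (pCons 0 p)\<close>, whose limit is known.\<close>
    have "((\<lambda>y. flat p y / y) \<longlongrightarrow> 0) (at 0)"
      by (rule Lim_transform_eventually[OF flat_tendsto_0[of "pCons 0 p"]])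
        (auto simp: flat_def eventually_at intro!: exI[of _ 1])
    then show ?thesis
      using 2 by (simp add: has_field_derivative_iff) (simp add: flat_def)
  next
    case 3
    have "((\<lambda>x. poly p (1 / x) * exp (- (1 / x))) has_real_derivative
        flat (monom 1 2 * (p - pderiv p)) x) (at x)"
      using 3 by (auto intro!: derivative_eq_intros DERIV_chain2[OF poly_DERIV]
          simp: flat_def poly_monom power2_eq_square field_simps)
    then show ?thesis
      by (rule DERIV_cong_ev[THEN iffD1, rotated 3])
        (use 3 in \<open>auto simp: flat_def intro!: eventually_nhds[THEN iffD2] exI[of _ "{0<..}"]\<close>)
  qed
qed

text \<open>Each partial derivative is a constant times another member of the same family, so
  induction on the order works once \<open>p\<close> is arbitrary. The affine argument lets the
  result apply directly to the factors of \<open>bump\<close>.\<close>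

lemma smooth_flat: "smooth (\<lambda>x. flat p (x \<bullet> v + d))"
  unfolding smooth_def
proof
  fix k show "Ck k (\<lambda>x. flat p (x \<bullet> v + d))"
  proof (induction k arbitrary: p)
    case 0
    have "continuous_on UNIV (flat p)"
      using flat_deriv by (meson DERIV_isCont continuous_at_imp_continuous_on)
    then show ?case
      by (auto intro!: continuous_on_compose2[of UNIV "flat p"] continuous_intros)
  next
    case (Suc k)
    let ?q = "monom 1 2 * (p - pderiv p)"
    have *: "((\<lambda>x. flat p (x \<bullet> v + d)) has_derivative (\<lambda>y. flat ?q (x \<bullet> v + d) * (y \<bullet> v))) (at x)" for x
      by (rule has_derivative_compose[OF _ flat_deriv[unfolded has_field_derivative_def]])
        (auto intro!: derivative_eq_intros)
    then have "partial i (\<lambda>x. flat p (x \<bullet> v + d)) = (\<lambda>x. flat ?q (x \<bullet> v + d) * (i \<bullet> v))" for i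
      using partial_eqI by blast
    then show ?case
      using * Suc by (auto simp: differentiable_def intro!: Ck_mult Ck_const)
  qed
qed

text \<open>The arguments are n (x_i - a_i) and n (b_i - x_i), spelled as affine forms to match
  \<open>smooth_flat\<close>. Increasing n drives every factor to 1 inside the box, while the value
  outside stays exactly 0.\<close>

definition bump :: "'a::euclidean_space \<Rightarrow> 'a \<Rightarrow> nat \<Rightarrow> 'a \<Rightarrow> real" where
  "bump a b n x = (\<Prod>i\<in>Basis. flat 1 (x \<bullet> (real n *\<^sub>R i) + (- real n * (a \<bullet> i))) *
     flat 1 (x \<bullet> (- real n *\<^sub>R i) + real n * (b \<bullet> i)))"

lemma flat_1_bounds: "0 \<le> flat 1 x" "flat 1 x \<le> 1"
  by (auto simp: flat_def)

lemma bump_bounds: "0 \<le> bump a b n x" "bump a b n x \<le> 1"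
  unfolding bump_def
  by (auto intro!: prod_nonneg prod_le_1 mult_nonneg_nonneg mult_le_one flat_1_bounds)

lemma bump_zero: "x \<notin> box a b \<Longrightarrow> bump a b n x = 0"
  unfolding bump_def mem_box prod_zero_iff[OF finite_Basis] mult_eq_0_iff
  by (auto simp: flat_def not_less intro!: bexI mult_left_mono)

lemma smooth_bump: "smooth (bump a b n)"
  unfolding bump_def by (intro smooth_prod smooth_mult smooth_flat)

lemma bump_test_function:
  assumes "cbox a b \<subseteq> \<Omega>"
  shows "bump a b n \<in> test_functions \<Omega>"
proof -
  have "closure {x. bump a b n x \<noteq> 0} \<subseteq> cbox a b"
    using bump_zero box_subset_cbox by (intro closure_minimal closed_cbox) blast
  then show ?thesis
    using assms smooth_bump[of a b n] bounded_subset[OF bounded_cbox]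
    by (auto simp: test_functions_def intro!: bounded_subset[OF bounded_cbox] intro: closure_subset[THEN subsetD])
qed

lemma flat_1_tendsto:
  assumes "t > 0"
  shows "(\<lambda>n. flat 1 (real n * t)) \<longlonglongrightarrow> 1"
proof -
  have "(\<lambda>n. exp (- (inverse t * inverse (real n)))) \<longlonglongrightarrow> exp (- (inverse t * 0))"
    by (intro tendsto_intros lim_inverse_n)
  moreover have "\<forall>\<^sub>F n in sequentially. exp (- (inverse t * inverse (real n))) = flat 1 (real n * t)"
    using eventually_gt_at_top[of 0] by eventually_elim
      (use assms in \<open>auto simp: flat_def field_simps mult_le_0_iff\<close>)
  ultimately show ?thesis
    by (simp add: filterlim_cong)
qed

lemma bump_tendsto: "(\<lambda>n. bump a b n x) \<longlonglongrightarrow> indicator (box a b) x"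
proof (cases "x \<in> box a b")
  case True
  have "(\<lambda>n. \<Prod>i\<in>Basis. flat 1 (real n * (x \<bullet> i - a \<bullet> i)) * flat 1 (real n * (b \<bullet> i - x \<bullet> i)))
      \<longlonglongrightarrow> (\<Prod>i\<in>(Basis :: 'a set). 1 * 1)"
    by (intro tendsto_prod tendsto_mult flat_1_tendsto) (use True in \<open>auto simp: mem_box\<close>)
  then show ?thesis
    using True by (simp add: bump_def algebra_simps)
qed (simp add: bump_zero)

section \<open>The fundamental lemma of the calculus of variations\<close>

lemma AE_eq_0_if_box_integrals_0:
  fixes f :: "'a::euclidean_space \<Rightarrow> real"
  assumes f: "integrable lborel f"
    and box: "\<And>a b. (LINT x:box a b|lborel. f x) = 0"
  shows "AE x in lborel. f x = 0"
proof (rule sigma_finite_measure.density_zero[OF sigma_finite_lborel f])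
  have int: "set_integrable lborel A f" if "A \<in> sets borel" for A
    using integrable_mult_indicator[of A lborel f] that f by (simp add: set_integrable_def)
  define A where "A n = box (- (real n *\<^sub>R One)) (real n *\<^sub>R One :: 'a)" for n
  \<comment> \<open>Exhausting the space by boxes gives total integral 0, which the complement case
    below relies on.\<close>
  have "(\<lambda>n. LINT x:A n|lborel. f x) \<longlonglongrightarrow> (LINT x:(\<Union>n. A n)|lborel. f x)"
  proof (rule set_integral_cont_up)
    show "incseq A"
      unfolding incseq_def A_def by (auto intro!: subset_box_imp)
  qed (auto simp: A_def int)
  then have "(LINT x:(\<Union>n. A n)|lborel. f x) = 0"
    unfolding A_def box by (rule LIMSEQ_unique[OF _ tendsto_const])
  then have UNIV: "integral\<^sup>L lborel f = 0"
    unfolding A_def UN_box_eq_UNIV by (simp add: set_lebesgue_integral_def)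
  let ?G = "range (\<lambda>(a, b). box a b :: 'a set)"
  fix X :: "'a set" assume "X \<in> sets lborel"
  then have X: "X \<in> sigma_sets UNIV ?G"
    by (simp add: borel_eq_box)
  have "Int_stable ?G"
    by (auto simp: Int_stable_def box_Int_box)
  \<comment> \<open>Dynkin's argument: boxes are stable under intersection and generate the Borel
    sets, and vanishing of the integral passes to complements and countable disjoint unions.\<close>
  from this subset_UNIV[of ?G, folded Pow_UNIV] X show "(LINT x:X|lborel. f x) = 0"
  proof (induction X rule: sigma_sets_induct_disjoint)
    case (basic A)
    then show ?case using box by auto
  next
    case empty
    show ?case by (simp add: set_lebesgue_integral_def)
  next
    case (compl A)
    then have "A \<in> sets borel" by (simp add: borel_eq_box)
    then have "(LINT x:A \<union> (UNIV - A)|lborel. f x) = (LINT x:A|lborel. f x) + (LINT x:UNIV - A|lborel. f x)"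
      by (intro set_integral_Un int) auto
    then show ?case using compl UNIV by (simp add: set_lebesgue_integral_def)
  next
    case (union A)
    then have "A i \<in> sets borel" for i by (auto simp: borel_eq_box)
    then have "(LINT x:(\<Union>i. A i)|lborel. f x) = (\<Sum>i. LINT x:A i|lborel. f x)"
      using union by (intro lebesgue_integral_countable_add int) (auto simp: disjoint_family_on_def)
    then show ?case using union by simp
  qed
qed

lemma borel_measurable_lebesgue_on_continuous:
  "continuous_on UNIV f \<Longrightarrow> f \<in> borel_measurable (lebesgue_on \<Omega>)"
  by (simp add: borel_measurable_continuous_onI measurable_completion measurable_restrict_space1)

text \<open>Bump functions converge to indicators of boxes, so \<open>f\<close> has integral 0 over
  each box whose closed box lies in \<Omega>. This gives f = 0 almost everywhere on each such closed
  box, and countably many of them cover \<Omega>.\<close>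

lemma fundamental_lemma_calculus_of_variations:
  fixes \<Omega> :: "'a::euclidean_space set" and f :: "'a \<Rightarrow> real"
  assumes \<Omega>: "open \<Omega>" and f: "integrable (lebesgue_on \<Omega>) f"
    and test: "\<And>\<phi>. \<phi> \<in> test_functions \<Omega> \<Longrightarrow> (LINT x|lebesgue_on \<Omega>. f x * \<phi> x) = 0"
  shows "AE x in lebesgue_on \<Omega>. f x = 0"
proof -
  have [measurable]: "\<Omega> \<in> sets borel" using \<Omega> by simp
  have \<Omega>': "\<Omega> \<inter> space lebesgue \<in> sets lebesgue" by simp
  \<comment> \<open>The function \<open>f\<close> is only Lebesgue measurable on \<Omega>. Its zero
    extension is replaced by a Borel representative \<open>g\<close>, to which the Dynkin argument
    on \<open>lborel\<close> applies.\<close>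
  let ?F = "\<lambda>x. indicator \<Omega> x *\<^sub>R f x"
  have F: "integrable lebesgue ?F"
    using f integrable_restrict_space[OF \<Omega>'] by blast
  then obtain g where g [measurable]: "g \<in> borel_measurable borel" and ae: "AE x in lborel. ?F x = g x"
    using completion_ex_borel_measurable_real[of ?F lborel] by auto
  have ae': "AE x in lebesgue. ?F x = g x" using ae by (rule AE_completion)
  have g_leb [measurable]: "g \<in> borel_measurable lebesgue"
    by (simp add: measurable_completion)
  have "integrable lebesgue g"
    by (rule integrable_cong_AE_imp[OF F g_leb ae'])
  then have gint: "integrable lborel g" by (simp add: integrable_completion)
  have boxes: "(LINT x:box a b|lborel. g x) = 0" if ab: "cbox a b \<subseteq> \<Omega>" for a b
  proof -
    have [measurable]: "bump a b n \<in> borel_measurable borel" for n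
      using smooth_bump smooth_continuous borel_measurable_continuous_onI by blast
    have "(LINT x|lborel. bump a b n x * g x) = 0" for n
    proof -
      have "(LINT x|lborel. bump a b n x * g x) = (LINT x|lebesgue. bump a b n x * g x)"
        by (rule integral_completion[symmetric]) measurable
      also have "\<dots> = (LINT x|lebesgue. bump a b n x * ?F x)"
        using ae' F[THEN borel_measurable_integrable]
        by (intro integral_cong_AE borel_measurable_times) (auto simp: measurable_completion)
      also have "\<dots> = (LINT x|lebesgue_on \<Omega>. f x * bump a b n x)"
        unfolding integral_restrict_space[OF \<Omega>'] by (simp add: mult_ac)
      finally show ?thesis using test bump_test_function[OF ab] by simp
    qed
    \<comment> \<open>Dominated convergence with majorant |g|, as the bumps take values in
      [0, 1].\<close>
    moreover have "(\<lambda>n. LINT x|lborel. bump a b n x * g x) \<longlonglongrightarrow> (LINT x|lborel. indicator (box a b) x * g x)"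
    proof (rule integral_dominated_convergence[where w = "\<lambda>x. norm (g x)"])
      show "AE x in lborel. (\<lambda>n. bump a b n x * g x) \<longlonglongrightarrow> indicator (box a b) x * g x"
        by (intro AE_I2 tendsto_mult_right bump_tendsto)
      show "AE x in lborel. norm (bump a b n x * g x) \<le> norm (g x)" for n
        by (auto simp: abs_mult bump_bounds intro!: mult_left_le_one_le)
    qed (use gint in auto)
    ultimately show ?thesis
      by (simp add: set_lebesgue_integral_def LIMSEQ_const_iff)
  qed
  \<comment> \<open>Cutting \<open>g\<close> off outside \<open>box c d\<close> makes every box
    admissible for the previous lemma, because intersections of boxes are boxes. The boundary of the
    box is a null set.\<close>
  have on_box: "AE x in lborel. x \<in> cbox c d \<longrightarrow> g x = 0" if cd: "cbox c d \<subseteq> \<Omega>" for c d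
  proof -
    have "AE x in lborel. indicator (box c d) x * g x = 0"
    proof (rule AE_eq_0_if_box_integrals_0)
      show "integrable lborel (\<lambda>x. indicator (box c d) x * g x)"
        using integrable_mult_indicator[OF _ gint] by simp
      fix a b
      obtain a' b' where ab': "box a b \<inter> box c d = box a' b'"
        using box_Int_box by blast
      have "(LINT x:box a b|lborel. indicator (box c d) x * g x) = (LINT x:box a' b'|lborel. g x)"
        unfolding ab'[symmetric] set_lebesgue_integral_def by (simp add: indicator_inter_arith mult.assoc)
      also have "\<dots> = 0"
      \<comment> \<open>An empty open box can have a nonempty degenerate closed box that leaves
        \<Omega>, so \<open>boxes\<close> is applied only in the nonempty case.\<close>
      proof (cases "box a' b' = {}")
        case False
        have "cbox a' b' = closure (box a' b')" using False by simp
        also have "\<dots> \<subseteq> cbox c d"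
          using ab' box_subset_cbox by (intro closure_minimal closed_cbox) blast
        finally show ?thesis using cd boxes by blast
      qed (simp add: set_lebesgue_integral_def)
      finally show "(LINT x:box a b|lborel. indicator (box c d) x * g x) = 0" .
    qed
    moreover have "AE x in lborel. x \<notin> cbox c d - box c d"
      by (rule AE_completion_iff[THEN iffD1, OF AE_not_in])
        (rule negligible_frontier_interval[unfolded negligible_iff_null_sets])
    ultimately show ?thesis by eventually_elim (auto simp del: mem_box)
  qed
  have "AE x in lborel. x \<in> \<Omega> \<longrightarrow> g x = 0"
  proof -
    define l where "l p = (\<Sum>i\<in>Basis. fst (p i) *\<^sub>R i)" for p :: "'a \<Rightarrow> real \<times> real"
    define r where "r p = (\<Sum>i\<in>Basis. snd (p i) *\<^sub>R i)" for p :: "'a \<Rightarrow> real \<times> real"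
    define I where "I = {p \<in> Basis \<rightarrow>\<^sub>E \<rat> \<times> \<rat>. cbox (l p) (r p) \<subseteq> \<Omega>}"
    have "\<Omega> = (\<Union>p\<in>I. cbox (l p) (r p))"
      using open_UNION_cbox[OF \<Omega>] by (simp add: I_def l_def r_def)
    moreover have "countable I"
      unfolding I_def by (intro countable_Collect countable_PiE countable_SIGMA countable_rat finite_Basis)
    moreover have "AE x in lborel. \<forall>p\<in>I. x \<in> cbox (l p) (r p) \<longrightarrow> g x = 0"
      using \<open>countable I\<close> on_box by (intro AE_ball_countable') (auto simp: I_def)
    ultimately show ?thesis by (elim eventually_mono) blast
  qed
  with ae have "AE x in lborel. x \<in> \<Omega> \<longrightarrow> f x = 0"
    by eventually_elim auto
  then show ?thesis
    by (intro AE_restrict_space_iff[OF \<Omega>', THEN iffD2] AE_completion)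
qed

section \<open>Square integrable functions\<close>

text \<open>The parallelogram law with one square dropped. Being an estimate of squares, it can be
  integrated directly and takes the place of Minkowski's inequality below.\<close>

lemma norm_lincomb_sq_le:
  fixes x y :: "'a::real_inner"
  shows "(norm (a *\<^sub>R x + b *\<^sub>R y))\<^sup>2 \<le> 2 * a\<^sup>2 * (norm x)\<^sup>2 + 2 * b\<^sup>2 * (norm y)\<^sup>2"
proof -
  have "(norm (v + w))\<^sup>2 + (norm (v - w))\<^sup>2 = 2 * (norm v)\<^sup>2 + 2 * (norm w)\<^sup>2" for v w :: 'a
    by (simp add: power2_norm_eq_inner inner_simps inner_commute)
  from this[of "a *\<^sub>R x" "b *\<^sub>R y"] show ?thesis
    using zero_le_power2[of "norm (a *\<^sub>R x - b *\<^sub>R y)"] unfolding norm_scaleR power_mult_distrib power2_abs by linarith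
qed

lemma L2_measurable: "f \<in> L2 M \<Longrightarrow> f \<in> borel_measurable M"
  by (simp add: L2_def)

lemma L2_integrable: "f \<in> L2 M \<Longrightarrow> integrable M (\<lambda>x. (norm (f x))\<^sup>2)"
  by (simp add: L2_def)

lemma L2_lincomb:
  assumes "f \<in> L2 M" "g \<in> L2 M"
  shows "(\<lambda>x. a *\<^sub>R f x + b *\<^sub>R g x) \<in> L2 M"
proof -
  have [measurable]: "f \<in> borel_measurable M" "g \<in> borel_measurable M"
    using assms by (auto dest: L2_measurable)
  have "integrable M (\<lambda>x. 2 * a\<^sup>2 * (norm (f x))\<^sup>2 + 2 * b\<^sup>2 * (norm (g x))\<^sup>2)"
    using assms by (simp add: L2_integrable)
  then have "integrable M (\<lambda>x. (norm (a *\<^sub>R f x + b *\<^sub>R g x))\<^sup>2)"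
    by (rule Bochner_Integration.integrable_bound) (auto intro!: order_trans[OF norm_lincomb_sq_le])
  then show ?thesis by (simp add: L2_def)
qed

lemmas L2_lincomb_real = L2_lincomb[where 'b = real, unfolded real_scaleR_def]

lemma L2_add: "f \<in> L2 M \<Longrightarrow> g \<in> L2 M \<Longrightarrow> (\<lambda>x. f x + g x) \<in> L2 M"
  using L2_lincomb[of f M g 1 1] by simp

lemma L2_diff: "f \<in> L2 M \<Longrightarrow> g \<in> L2 M \<Longrightarrow> (\<lambda>x. f x - g x) \<in> L2 M"
  using L2_lincomb[of f M g 1 "-1"] by simp

text \<open>By polarization the inner product is a combination of three integrable squares.\<close>

lemma L2_integrable_inner:
  assumes "f \<in> L2 M" "g \<in> L2 M"
  shows "integrable M (\<lambda>x. f x \<bullet> g x)"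
proof -
  have [measurable]: "f \<in> borel_measurable M" "g \<in> borel_measurable M"
    using assms by (auto dest: L2_measurable)
  have "integrable M (\<lambda>x. (norm (f x + g x))\<^sup>2)"
    using assms by (intro L2_integrable L2_add)
  then have "integrable M (\<lambda>x. ((norm (f x + g x))\<^sup>2 - (norm (f x))\<^sup>2 - (norm (g x))\<^sup>2) / 2)"
    using assms by (simp add: L2_integrable)
  moreover have "((norm (x + y))\<^sup>2 - (norm x)\<^sup>2 - (norm y)\<^sup>2) / 2 = x \<bullet> y" for x y :: 'b
    by (simp add: power2_norm_eq_inner inner_simps inner_commute)
  ultimately show ?thesis by simp
qed

lemma L2_inner_const:
  assumes "f \<in> L2 M"
  shows "(\<lambda>x. f x \<bullet> i) \<in> L2 M"
proof -
  have [measurable]: "f \<in> borel_measurable M"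
    using assms by (rule L2_measurable)
  have "integrable M (\<lambda>x. (norm i)\<^sup>2 * (norm (f x))\<^sup>2)"
    using assms by (simp add: L2_integrable)
  then have "integrable M (\<lambda>x. (f x \<bullet> i)\<^sup>2)"
    by (rule Bochner_Integration.integrable_bound)
      (auto simp: power_mult_distrib[symmetric] abs_le_square_iff[symmetric] mult.commute[of "norm i"] Cauchy_Schwarz_ineq2)
  then show ?thesis by (simp add: L2_def)
qed

lemma L2_norm_sq: "(L2_norm M f)\<^sup>2 = (LINT x|M. (norm (f x))\<^sup>2)"
  by (simp add: L2_norm_def integral_nonneg_AE)

lemma L2_norm_nonneg: "0 \<le> L2_norm M f"
  by (simp add: L2_norm_def integral_nonneg_AE)

lemma L2_norm_lincomb_sq_le:
  assumes "f \<in> L2 M" "g \<in> L2 M"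
  shows "(L2_norm M (\<lambda>x. a *\<^sub>R f x + b *\<^sub>R g x))\<^sup>2 \<le> 2 * a\<^sup>2 * (L2_norm M f)\<^sup>2 + 2 * b\<^sup>2 * (L2_norm M g)\<^sup>2"
proof -
  have "(LINT x|M. (norm (a *\<^sub>R f x + b *\<^sub>R g x))\<^sup>2)
      \<le> (LINT x|M. 2 * a\<^sup>2 * (norm (f x))\<^sup>2 + 2 * b\<^sup>2 * (norm (g x))\<^sup>2)"
    using assms by (intro integral_mono norm_lincomb_sq_le) (simp_all add: L2_integrable L2_lincomb)
  also have "\<dots> = 2 * a\<^sup>2 * (LINT x|M. (norm (f x))\<^sup>2) + 2 * b\<^sup>2 * (LINT x|M. (norm (g x))\<^sup>2)"
    using assms by (simp add: L2_integrable)
  finally show ?thesis by (simp add: L2_norm_sq)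
qed

lemma L2_integral_affine_sq:
  assumes "f \<in> L2 M" "g \<in> L2 M"
  shows "(LINT x|M. (norm (f x + t *\<^sub>R g x))\<^sup>2) =
    (LINT x|M. (norm (f x))\<^sup>2) + 2 * t * (LINT x|M. f x \<bullet> g x) + t\<^sup>2 * (LINT x|M. (norm (g x))\<^sup>2)"
proof -
  have "(norm (f x + t *\<^sub>R g x))\<^sup>2 = (norm (f x))\<^sup>2 + 2 * t * (f x \<bullet> g x) + t\<^sup>2 * (norm (g x))\<^sup>2" for x
    unfolding power2_norm_eq_inner by (simp add: inner_simps inner_commute power2_eq_square algebra_simps)
  then show ?thesis
    using assms by (simp add: L2_integrable L2_integrable_inner)
qed

text \<open>The cross terms cancel by symmetry. This identity turns the vanishing first variation
  into a balance of squared norms.\<close>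

lemma L2_integral_diff_sq:
  assumes "f \<in> L2 M" "g \<in> L2 M"
  shows "(LINT x|M. (f x + g x) \<bullet> (f x - g x)) = (LINT x|M. (norm (f x))\<^sup>2) - (LINT x|M. (norm (g x))\<^sup>2)"
proof -
  have "(f x + g x) \<bullet> (f x - g x) = (norm (f x))\<^sup>2 - (norm (g x))\<^sup>2" for x
    by (simp add: power2_norm_eq_inner inner_simps inner_commute)
  then show ?thesis
    using assms by (simp add: L2_integrable)
qed

text \<open>Turns squared estimates into convergence, for the L2 norm and the H1 norm alike.\<close>

lemma tendsto_0_lincomb_sq:
  fixes f g e :: "nat \<Rightarrow> real"
  assumes "f \<longlonglongrightarrow> 0" "g \<longlonglongrightarrow> 0"
    and "\<And>n. 0 \<le> e n" "\<And>n. (e n)\<^sup>2 \<le> a * (f n)\<^sup>2 + b * (g n)\<^sup>2"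
  shows "e \<longlonglongrightarrow> 0"
proof -
  have "(\<lambda>n. a * (f n)\<^sup>2 + b * (g n)\<^sup>2) \<longlonglongrightarrow> a * 0\<^sup>2 + b * 0\<^sup>2"
    using assms by (intro tendsto_intros)
  then have lim: "(\<lambda>n. a * (f n)\<^sup>2 + b * (g n)\<^sup>2) \<longlonglongrightarrow> 0" by simp
  have "(\<lambda>n. (e n)\<^sup>2) \<longlonglongrightarrow> 0"
    by (rule tendsto_sandwich[OF _ _ tendsto_const lim]) (simp_all add: assms(4))
  then show ?thesis by (simp add: power_tendsto_0_iff)
qed

lemma L2_tendsto_lincomb:
  fixes f g :: "nat \<Rightarrow> 'a \<Rightarrow> real"
  assumes "L2_tendsto M f u" "L2_tendsto M g w"
  shows "L2_tendsto M (\<lambda>n x. a * f n x + b * g n x) (\<lambda>x. a * u x + b * w x)"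
proof -
  have fu: "(\<lambda>x. f n x - u x) \<in> L2 M" and gw: "(\<lambda>x. g n x - w x) \<in> L2 M" for n
    using assms by (auto simp: L2_tendsto_def L2_diff)
  have "(L2_norm M (\<lambda>x. (a * f n x + b * g n x) - (a * u x + b * w x)))\<^sup>2 \<le>
      2 * a\<^sup>2 * (L2_norm M (\<lambda>x. f n x - u x))\<^sup>2 + 2 * b\<^sup>2 * (L2_norm M (\<lambda>x. g n x - w x))\<^sup>2" for n
    using L2_norm_lincomb_sq_le[OF fu[of n] gw[of n], of a b] by (simp add: algebra_simps)
  then have "(\<lambda>n. L2_norm M (\<lambda>x. (a * f n x + b * g n x) - (a * u x + b * w x))) \<longlonglongrightarrow> 0"
    by (rule tendsto_0_lincomb_sq[OF _ _ L2_norm_nonneg, rotated 2]) (use assms in \<open>auto simp: L2_tendsto_def\<close>)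
  then show ?thesis
    using assms by (simp add: L2_tendsto_def L2_lincomb_real)
qed

section \<open>Weak gradients\<close>

context
  fixes \<Omega> :: "'a::euclidean_space set"
  assumes \<Omega>: "open \<Omega>" "bounded \<Omega>"
begin

text \<open>Such a function is bounded on the compact closure of \<Omega>, and \<Omega> has finite
  measure. Hence test functions and their partial derivatives can be paired with L2
  functions.\<close>

lemma continuous_L2:
  assumes "continuous_on UNIV f"
  shows "f \<in> L2 (lebesgue_on \<Omega>)"
proof -
  have [measurable]: "f \<in> borel_measurable (lebesgue_on \<Omega>)"
    using assms by (rule borel_measurable_lebesgue_on_continuous)
  interpret finite_measure "lebesgue_on \<Omega>"
    using \<Omega> by (intro finite_measure_lebesgue_on bounded_set_imp_lmeasurable) auto
  have "compact (f ` closure \<Omega>)"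
    using \<Omega> by (intro compact_continuous_image continuous_on_subset[OF assms]) auto
  then obtain B where "\<forall>y\<in>f ` closure \<Omega>. norm y \<le> B"
    using compact_imp_bounded bounded_iff by metis
  then have B: "norm (f x) \<le> B" if "x \<in> \<Omega>" for x
    using that closure_subset by blast
  have "integrable (lebesgue_on \<Omega>) (\<lambda>x. (norm (f x))\<^sup>2)"
    by (rule integrable_const_bound[where B = "B\<^sup>2"]) (auto intro!: power_mono B)
  then show ?thesis by (simp add: L2_def)
qed

lemma test_function_L2: "\<phi> \<in> test_functions \<Omega> \<Longrightarrow> \<phi> \<in> L2 (lebesgue_on \<Omega>)"
  by (simp add: test_functions_def continuous_L2 smooth_continuous)

lemma test_function_partial_L2:
  "\<phi> \<in> test_functions \<Omega> \<Longrightarrow> i \<in> Basis \<Longrightarrow> partial i \<phi> \<in> L2 (lebesgue_on \<Omega>)"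
  by (simp add: test_functions_def continuous_L2 smooth_partial_continuous)

text \<open>The L2 hypotheses make all products with test functions integrable, so that the
  integrals may be split.\<close>

lemma has_weak_gradient_lincomb:
  assumes "u \<in> L2 (lebesgue_on \<Omega>)" "g \<in> L2 (lebesgue_on \<Omega>)" "has_weak_gradient \<Omega> u g"
    and "w \<in> L2 (lebesgue_on \<Omega>)" "k \<in> L2 (lebesgue_on \<Omega>)" "has_weak_gradient \<Omega> w k"
  shows "has_weak_gradient \<Omega> (\<lambda>x. a * u x + b * w x) (\<lambda>x. a *\<^sub>R g x + b *\<^sub>R k x)"
  unfolding has_weak_gradient_def
proof (intro ballI)
  fix \<phi> :: "'a \<Rightarrow> real" and i :: 'a assume \<phi>: "\<phi> \<in> test_functions \<Omega>" and i: "i \<in> Basis"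
  let ?M = "lebesgue_on \<Omega>"
  have int: "integrable ?M (\<lambda>x. f x * partial i \<phi> x)" "integrable ?M (\<lambda>x. f x * \<phi> x)"
    if "f \<in> L2 ?M" for f
    using L2_integrable_inner[OF that] test_function_L2[OF \<phi>] test_function_partial_L2[OF \<phi> i]
    by auto
  have "(LINT x|?M. (a * u x + b * w x) * partial i \<phi> x)
      = (LINT x|?M. a * (u x * partial i \<phi> x) + b * (w x * partial i \<phi> x))"
    by (simp add: algebra_simps)
  also have "\<dots> = a * (LINT x|?M. u x * partial i \<phi> x) + b * (LINT x|?M. w x * partial i \<phi> x)"
    using assms int by simp
  also have "\<dots> = - (a * (LINT x|?M. (g x \<bullet> i) * \<phi> x) + b * (LINT x|?M. (k x \<bullet> i) * \<phi> x))"
    using assms \<phi> i by (simp add: has_weak_gradient_def)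
  also have "\<dots> = - (LINT x|?M. a * ((g x \<bullet> i) * \<phi> x) + b * ((k x \<bullet> i) * \<phi> x))"
    using int(2)[OF L2_inner_const[OF assms(2)], of i] int(2)[OF L2_inner_const[OF assms(5)], of i] by simp
  also have "\<dots> = - (LINT x|?M. ((a *\<^sub>R g x + b *\<^sub>R k x) \<bullet> i) * \<phi> x)"
    by (simp add: algebra_simps)
  finally show "(LINT x|?M. (a * u x + b * w x) * partial i \<phi> x)
      = - (LINT x|?M. ((a *\<^sub>R g x + b *\<^sub>R k x) \<bullet> i) * \<phi> x)" .
qed

text \<open>Tested against \<phi>, the components of both gradients give minus the integral of u
  times a partial derivative of \<phi>. The fundamental lemma applies to each of the finitely many
  coordinates of the difference.\<close>

lemma weak_gradient_unique:
  assumes "g \<in> L2 (lebesgue_on \<Omega>)" "has_weak_gradient \<Omega> u g"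
    and "k \<in> L2 (lebesgue_on \<Omega>)" "has_weak_gradient \<Omega> u k"
  shows "AE x in lebesgue_on \<Omega>. g x = k x"
proof -
  let ?M = "lebesgue_on \<Omega>"
  have "AE x in ?M. (g x - k x) \<bullet> i = 0" if i: "i \<in> Basis" for i
  proof (rule fundamental_lemma_calculus_of_variations[OF \<Omega>(1)])
    have L2: "(\<lambda>x. (g x - k x) \<bullet> i) \<in> L2 ?M"
      using assms by (intro L2_inner_const L2_diff)
    \<comment> \<open>Pairing with the constant 1, which is in L2 because \<Omega> is
      bounded.\<close>
    show "integrable ?M (\<lambda>x. (g x - k x) \<bullet> i)"
      using L2_integrable_inner[OF L2 continuous_L2[of "\<lambda>x. 1"]] by simp
    fix \<phi> :: "'a \<Rightarrow> real" assume \<phi>: "\<phi> \<in> test_functions \<Omega>"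
    have int: "integrable ?M (\<lambda>x. (f x \<bullet> i) * \<phi> x)" if "f \<in> L2 ?M" for f
      using L2_integrable_inner[OF L2_inner_const[OF that] test_function_L2[OF \<phi>]] by simp
    have "(LINT x|?M. ((g x - k x) \<bullet> i) * \<phi> x)
        = (LINT x|?M. (g x \<bullet> i) * \<phi> x) - (LINT x|?M. (k x \<bullet> i) * \<phi> x)"
      using int assms by (simp add: inner_diff_left left_diff_distrib)
    moreover have "(LINT x|?M. (g x \<bullet> i) * \<phi> x) = (LINT x|?M. (k x \<bullet> i) * \<phi> x)"
      using assms(2,4)[unfolded has_weak_gradient_def, rule_format, OF \<phi> i] by simp
    ultimately show "(LINT x|?M. ((g x - k x) \<bullet> i) * \<phi> x) = 0" by simp
  qed
  then have "AE x in ?M. \<forall>i\<in>Basis. (g x - k x) \<bullet> i = 0"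
    by (intro AE_finite_allI) auto
  then show ?thesis
    by (rule eventually_mono, intro euclidean_eqI[where 'a = 'a]) (simp add: inner_diff_left)
qed

section \<open>Linear structure of H1 and the chosen gradient\<close>

lemma grad_H1:
  assumes "u \<in> H1 \<Omega>"
  shows "grad \<Omega> u \<in> L2 (lebesgue_on \<Omega>)" "has_weak_gradient \<Omega> u (grad \<Omega> u)"
proof -
  have "\<exists>g. g \<in> L2 (lebesgue_on \<Omega>) \<and> has_weak_gradient \<Omega> u g"
    using assms by (auto simp: H1_def)
  from someI_ex[OF this]
  show "grad \<Omega> u \<in> L2 (lebesgue_on \<Omega>)" "has_weak_gradient \<Omega> u (grad \<Omega> u)"
    by (auto simp: grad_def)
qed

lemma H1_L2: "u \<in> H1 \<Omega> \<Longrightarrow> u \<in> L2 (lebesgue_on \<Omega>)"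
  by (simp add: H1_def)

lemma H1_lincomb:
  assumes "u \<in> H1 \<Omega>" "w \<in> H1 \<Omega>"
  shows "(\<lambda>x. a * u x + b * w x) \<in> H1 \<Omega>"
  using has_weak_gradient_lincomb[OF H1_L2 grad_H1 H1_L2 grad_H1, OF assms(1,1,1) assms(2,2,2)]
    L2_lincomb[OF grad_H1(1) grad_H1(1), OF assms] L2_lincomb_real[OF H1_L2 H1_L2, OF assms]
  unfolding H1_def by blast

text \<open>Both sides are weak gradients of the same function. As \<open>grad\<close> is a choice,
  they need only agree almost everywhere.\<close>

lemma grad_lincomb:
  assumes "u \<in> H1 \<Omega>" "w \<in> H1 \<Omega>"
  shows "AE x in lebesgue_on \<Omega>. grad \<Omega> (\<lambda>x. a * u x + b * w x) x = a *\<^sub>R grad \<Omega> u x + b *\<^sub>R grad \<Omega> w x"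
  by (rule weak_gradient_unique[OF grad_H1[OF H1_lincomb[OF assms]] L2_lincomb[OF grad_H1(1) grad_H1(1), OF assms]
    has_weak_gradient_lincomb[OF H1_L2 grad_H1 H1_L2 grad_H1, OF assms(1,1,1) assms(2,2,2)]])

lemma H1_norm_nonneg: "0 \<le> H1_norm \<Omega> u"
  by (simp add: H1_norm_def)

lemma H1_norm_lincomb_sq_le:
  assumes "u \<in> H1 \<Omega>" "w \<in> H1 \<Omega>"
  shows "(H1_norm \<Omega> (\<lambda>x. a * u x + b * w x))\<^sup>2 \<le> 2 * a\<^sup>2 * (H1_norm \<Omega> u)\<^sup>2 + 2 * b\<^sup>2 * (H1_norm \<Omega> w)\<^sup>2"
proof -
  let ?M = "lebesgue_on \<Omega>"
  have "(L2_norm ?M (grad \<Omega> (\<lambda>x. a * u x + b * w x)))\<^sup>2 = (L2_norm ?M (\<lambda>x. a *\<^sub>R grad \<Omega> u x + b *\<^sub>R grad \<Omega> w x))\<^sup>2"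
    unfolding L2_norm_sq
  proof (rule integral_cong_AE)
    show "AE x in ?M. (norm (grad \<Omega> (\<lambda>x. a * u x + b * w x) x))\<^sup>2 = (norm (a *\<^sub>R grad \<Omega> u x + b *\<^sub>R grad \<Omega> w x))\<^sup>2"
      using grad_lincomb[OF assms, of a b] by eventually_elim simp
  qed (intro borel_measurable_integrable L2_integrable L2_lincomb grad_H1 H1_lincomb assms)+
  also have "\<dots> \<le> 2 * a\<^sup>2 * (L2_norm ?M (grad \<Omega> u))\<^sup>2 + 2 * b\<^sup>2 * (L2_norm ?M (grad \<Omega> w))\<^sup>2"
    using assms by (intro L2_norm_lincomb_sq_le grad_H1)
  finally show ?thesis
    using L2_norm_lincomb_sq_le[OF H1_L2 H1_L2, OF assms, of a b]
    by (simp add: H1_norm_def algebra_simps)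
qed

lemma H1_tendsto_lincomb:
  assumes "H1_tendsto \<Omega> f u" "H1_tendsto \<Omega> g w"
  shows "H1_tendsto \<Omega> (\<lambda>n x. a * f n x + b * g n x) (\<lambda>x. a * u x + b * w x)"
proof -
  have fu: "(\<lambda>x. f n x - u x) \<in> H1 \<Omega>" and gw: "(\<lambda>x. g n x - w x) \<in> H1 \<Omega>" for n
    using assms H1_lincomb[of _ _ 1 "-1"] by (auto simp: H1_tendsto_def)
  have "(H1_norm \<Omega> (\<lambda>x. (a * f n x + b * g n x) - (a * u x + b * w x)))\<^sup>2 \<le>
      2 * a\<^sup>2 * (H1_norm \<Omega> (\<lambda>x. f n x - u x))\<^sup>2 + 2 * b\<^sup>2 * (H1_norm \<Omega> (\<lambda>x. g n x - w x))\<^sup>2" for n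
    using H1_norm_lincomb_sq_le[OF fu[of n] gw[of n], of a b] by (simp add: algebra_simps)
  then have "(\<lambda>n. H1_norm \<Omega> (\<lambda>x. (a * f n x + b * g n x) - (a * u x + b * w x))) \<longlonglongrightarrow> 0"
    by (rule tendsto_0_lincomb_sq[OF _ _ H1_norm_nonneg, rotated 2]) (use assms in \<open>auto simp: H1_tendsto_def\<close>)
  then show ?thesis
    using assms by (simp add: H1_tendsto_def H1_lincomb)
qed

section \<open>Traces\<close>

lemma has_trace_lincomb:
  assumes "has_trace \<Omega> u g" "has_trace \<Omega> w k"
  shows "has_trace \<Omega> (\<lambda>x. a * u x + b * w x) (\<lambda>x. a * g x + b * k x)"
proof -
  obtain \<phi> where \<phi>: "\<forall>n. smooth (\<phi> n)" "H1_tendsto \<Omega> \<phi> u" "L2_tendsto (surface_measure \<Omega>) \<phi> g"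
    using assms(1) unfolding has_trace_def by blast
  obtain \<psi> where \<psi>: "\<forall>n. smooth (\<psi> n)" "H1_tendsto \<Omega> \<psi> w" "L2_tendsto (surface_measure \<Omega>) \<psi> k"
    using assms(2) unfolding has_trace_def by blast
  show ?thesis
    unfolding has_trace_def
    using \<phi> \<psi>
    by (intro exI[of _ "\<lambda>n x. a * \<phi> n x + b * \<psi> n x"])
      (auto intro!: H1_tendsto_lincomb L2_tendsto_lincomb smooth_add smooth_mult smooth_const)
qed

lemma H1_0_H1: "v \<in> H1_0 \<Omega> \<Longrightarrow> v \<in> H1 \<Omega>"
  by (auto simp: H1_0_def H1_tendsto_def)

text \<open>The approximating test functions serve as witnesses: their supports lie in the open set
  \<Omega>, which is disjoint from its frontier, so they vanish identically there.\<close>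

lemma H1_0_has_trace_0:
  assumes "v \<in> H1_0 \<Omega>"
  shows "has_trace \<Omega> v (\<lambda>x. 0)"
proof -
  let ?S = "surface_measure \<Omega>"
  obtain \<phi> where \<phi>: "\<And>n. \<phi> n \<in> test_functions \<Omega>" "H1_tendsto \<Omega> \<phi> v"
    using assms by (auto simp: H1_0_def)
  have zero: "\<phi> n x = 0" if "x \<in> space ?S" for n x
  proof -
    have "x \<notin> \<Omega>"
      using that \<Omega>(1) by (auto simp: surface_measure_def space_restrict_space frontier_def interior_open)
    then show ?thesis
      using \<phi>(1)[of n] closure_subset[of "{x. \<phi> n x \<noteq> 0}"] by (auto simp: test_functions_def)
  qed
  have "\<phi> n \<in> L2 ?S" for n
    using measurable_cong[of ?S "\<phi> n" "\<lambda>x. 0" borel]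
      Bochner_Integration.integrable_cong[of ?S ?S "\<lambda>x. (norm (\<phi> n x))\<^sup>2" "\<lambda>x. 0"]
    by (simp add: L2_def zero)
  moreover have "L2_norm ?S (\<lambda>x. \<phi> n x - 0) = 0" for n
    using Bochner_Integration.integral_cong[of ?S ?S "\<lambda>x. (norm (\<phi> n x))\<^sup>2" "\<lambda>x. 0"]
    by (simp add: L2_norm_def zero)
  ultimately have "L2_tendsto ?S \<phi> (\<lambda>x. 0)"
    by (simp add: L2_tendsto_def) (simp add: L2_def)
  then show ?thesis
    using \<phi> by (auto simp: has_trace_def test_functions_def)
qed

text \<open>The weights sum to 1, so the boundary datum cancels. All real t are allowed, which later
  permits variations of both signs.\<close>

lemma admissible_affine:
  assumes "u \<in> admissible \<Omega> u0" "w \<in> admissible \<Omega> u0"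
  shows "(\<lambda>x. (1 - t) * u x + t * w x) \<in> admissible \<Omega> u0"
proof -
  have "has_trace \<Omega> (\<lambda>x. (1 - t) * (u x - u0 x) + t * (w x - u0 x)) (\<lambda>x. (1 - t) * 0 + t * 0)"
    using assms by (intro has_trace_lincomb) (auto simp: admissible_def eq_in_trace_def)
  then have "has_trace \<Omega> (\<lambda>x. (1 - t) * u x + t * w x - u0 x) (\<lambda>x. 0)"
    by (simp add: algebra_simps)
  then show ?thesis
    using assms by (simp add: admissible_def eq_in_trace_def H1_lincomb)
qed

text \<open>Covers both initial iterates: \<open>c = 0\<close> gives u_0 and \<open>c = h\<close>
  gives u_1.\<close>

lemma admissible_add_H1_0:
  assumes "u0 \<in> H1 \<Omega>" "v \<in> H1_0 \<Omega>"
  shows "(\<lambda>x. u0 x + c * v x) \<in> admissible \<Omega> u0"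
  using has_trace_lincomb[OF H1_0_has_trace_0 H1_0_has_trace_0, OF assms(2,2), of c 0]
    H1_lincomb[OF assms(1) H1_0_H1[OF assms(2)], of 1 c]
  by (simp add: admissible_def eq_in_trace_def)

section \<open>Conservation of energy\<close>

text \<open>Near 0 the linear term dominates. At t = - s a the expression is s a^2 (s b - 1), which
  is negative for small s > 0 if a is nonzero.\<close>

lemma quadratic_nonneg_imp_linear_coeff_0:
  fixes a b :: real
  assumes "\<And>t. 0 \<le> t * a + t\<^sup>2 * b"
  shows "a = 0"
proof (rule ccontr)
  assume "a \<noteq> 0"
  \<comment> \<open>This choice gives s b < 1 for either sign of b.\<close>
  define s where "s = 1 / (\<bar>b\<bar> + 1)"
  have s: "s > 0" "s * b < 1"
    by (auto simp: s_def field_simps)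
  have "0 \<le> s * a\<^sup>2 * (s * b - 1)"
    using assms[of "- s * a"] by (simp add: power2_eq_square algebra_simps)
  moreover have "s * a\<^sup>2 > 0" using s \<open>a \<noteq> 0\<close> by simp
  ultimately show False using s by (simp add: zero_le_mult_iff)
qed

text \<open>On the line from \<open>w\<close> to \<open>q\<close> both integrands are squared norms
  of affine functions of t, so the functional is quadratic in t. Its linear coefficient is rewritten
  by differences of squares.\<close>

lemma step_functional_affine:
  fixes h :: real
  assumes p: "p \<in> H1 \<Omega>" and q: "q \<in> H1 \<Omega>" and w: "w \<in> H1 \<Omega>"
  shows "\<exists>c. \<forall>t. step_functional \<Omega> h p q (\<lambda>x. (1 - t) * w x + t * q x) = step_functional \<Omega> h p q w
    - t * (((LINT x|lebesgue_on \<Omega>. (w x - p x)\<^sup>2) - (LINT x|lebesgue_on \<Omega>. (p x - q x)\<^sup>2)) / h\<^sup>2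
      + 1 / 2 * ((LINT x|lebesgue_on \<Omega>. (norm (grad \<Omega> w x))\<^sup>2) - (LINT x|lebesgue_on \<Omega>. (norm (grad \<Omega> q x))\<^sup>2)))
    + t\<^sup>2 * c"
proof -
  let ?M = "lebesgue_on \<Omega>"
  let ?G = "grad \<Omega>"
  \<comment> \<open>\<open>A\<close> and \<open>C\<close> are the arguments of the two squares at
    \<open>w\<close>; at parameter t they become A - t B and C - t D.\<close>
  define A where "A x = w x - 2 * p x + q x" for x
  define B where "B x = w x - q x" for x
  define C where "C x = ?G w x + ?G q x" for x
  define D where "D x = ?G w x - ?G q x" for x
  note L2s = H1_L2[OF p] H1_L2[OF q] H1_L2[OF w] grad_H1(1)[OF q] grad_H1(1)[OF w]
  have AL: "A \<in> L2 ?M"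
    using L2_add[OF L2_lincomb_real[OF L2s(3) L2s(1), of 1 "-2"] L2s(2)] by (simp add: A_def[abs_def])
  have BL: "B \<in> L2 ?M" and CL: "C \<in> L2 ?M" and DL: "D \<in> L2 ?M"
    unfolding B_def[abs_def] C_def[abs_def] D_def[abs_def] using L2s by (auto intro: L2_diff L2_add)
  have "(LINT x|?M. A x \<bullet> B x) = (LINT x|?M. ((w x - p x) + (p x - q x)) \<bullet> ((w x - p x) - (p x - q x)))"
    by (simp add: A_def B_def algebra_simps)
  also have "\<dots> = (LINT x|?M. (norm (w x - p x))\<^sup>2) - (LINT x|?M. (norm (p x - q x))\<^sup>2)"
    using L2s by (intro L2_integral_diff_sq L2_diff)
  finally have AB: "(LINT x|?M. A x \<bullet> B x) = (LINT x|?M. (w x - p x)\<^sup>2) - (LINT x|?M. (p x - q x)\<^sup>2)"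
    by simp
  have CD: "(LINT x|?M. C x \<bullet> D x) = (LINT x|?M. (norm (?G w x))\<^sup>2) - (LINT x|?M. (norm (?G q x))\<^sup>2)"
    unfolding C_def D_def using L2s by (intro L2_integral_diff_sq)
  have step: "step_functional \<Omega> h p q (\<lambda>x. (1 - t) * w x + t * q x) =
      (LINT x|?M. (norm (A x + (- t) *\<^sub>R B x))\<^sup>2) / (2 * h\<^sup>2) + 1 / 4 * (LINT x|?M. (norm (C x + (- t) *\<^sub>R D x))\<^sup>2)" for t
  proof -
    let ?r = "\<lambda>x. (1 - t) * w x + t * q x"
    have affine: "((1 - t) *\<^sub>R y + t *\<^sub>R z) + z = (y + z) + (- t) *\<^sub>R (y - z)" for y z :: 'a
      by (simp add: algebra_simps)
    have "(LINT x|?M. (norm (?G ?r x + ?G q x))\<^sup>2) = (LINT x|?M. (norm (C x + (- t) *\<^sub>R D x))\<^sup>2)"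
    proof (rule integral_cong_AE)
      show "AE x in ?M. (norm (?G ?r x + ?G q x))\<^sup>2 = (norm (C x + (- t) *\<^sub>R D x))\<^sup>2"
        using grad_lincomb[OF w q, of "1 - t" t]
        by eventually_elim (simp only: C_def D_def affine)
      show "(\<lambda>x. (norm (?G ?r x + ?G q x))\<^sup>2) \<in> borel_measurable ?M"
        by (intro borel_measurable_integrable L2_integrable L2_add grad_H1 H1_lincomb w q)
      show "(\<lambda>x. (norm (C x + (- t) *\<^sub>R D x))\<^sup>2) \<in> borel_measurable ?M"
        using L2_lincomb[OF CL DL, of 1 "- t"] by (intro borel_measurable_integrable L2_integrable) simp
    qed
    moreover have "(LINT x|?M. \<bar>?r x - 2 * p x + q x\<bar>\<^sup>2 / (2 * h\<^sup>2)) = (LINT x|?M. (norm (A x + (- t) *\<^sub>R B x))\<^sup>2) / (2 * h\<^sup>2)"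
      by (simp add: A_def B_def algebra_simps)
    ultimately show ?thesis by (simp add: step_functional_def)
  qed
  have step0: "step_functional \<Omega> h p q w = (LINT x|?M. (norm (A x))\<^sup>2) / (2 * h\<^sup>2) + 1 / 4 * (LINT x|?M. (norm (C x))\<^sup>2)"
    using step[of 0] by simp
  have "step_functional \<Omega> h p q (\<lambda>x. (1 - t) * w x + t * q x) = step_functional \<Omega> h p q w
    - t * ((LINT x|?M. A x \<bullet> B x) / h\<^sup>2 + 1 / 2 * (LINT x|?M. C x \<bullet> D x))
    + t\<^sup>2 * ((LINT x|?M. (norm (B x))\<^sup>2) / (2 * h\<^sup>2) + 1 / 4 * (LINT x|?M. (norm (D x))\<^sup>2))" for t
    unfolding step0 step L2_integral_affine_sq[OF AL BL] L2_integral_affine_sq[OF CL DL]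
    by (simp add: add_divide_distrib diff_divide_distrib algebra_simps)
  then show ?thesis unfolding AB CD by blast
qed

text \<open>Both sides become consecutive energies after adding \<open>1 / 2 * \<parallel>\<nabla>p\<parallel>\<^sup>2\<close>.\<close>

lemma energy_step:
  fixes h :: real
  assumes p: "p \<in> H1 \<Omega>" and q: "q \<in> admissible \<Omega> u0"
    and w: "is_arg_min (step_functional \<Omega> h p q) (\<lambda>w. w \<in> admissible \<Omega> u0) w"
  shows "(LINT x|lebesgue_on \<Omega>. (w x - p x)\<^sup>2) / h\<^sup>2 + 1 / 2 * (LINT x|lebesgue_on \<Omega>. (norm (grad \<Omega> w x))\<^sup>2)
    = (LINT x|lebesgue_on \<Omega>. (p x - q x)\<^sup>2) / h\<^sup>2 + 1 / 2 * (LINT x|lebesgue_on \<Omega>. (norm (grad \<Omega> q x))\<^sup>2)"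
    (is "?W = ?Q")
proof -
  have adm: "w \<in> admissible \<Omega> u0"
    and min: "\<And>r. r \<in> admissible \<Omega> u0 \<Longrightarrow> step_functional \<Omega> h p q w \<le> step_functional \<Omega> h p q r"
    using w by (auto simp: is_arg_min_def not_less)
  have "q \<in> H1 \<Omega>" "w \<in> H1 \<Omega>"
    using q adm by (auto simp: admissible_def)
  from step_functional_affine[OF p this, of h]
  obtain c where c: "step_functional \<Omega> h p q (\<lambda>x. (1 - t) * w x + t * q x)
      = step_functional \<Omega> h p q w + t * (?Q - ?W) + t\<^sup>2 * c" for t
    by (auto simp: diff_divide_distrib algebra_simps)
  \<comment> \<open>Since \<open>q\<close> is admissible, so is the whole line through
    \<open>w\<close> and \<open>q\<close>, and minimality at \<open>w\<close> compares with every
    real t.\<close>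
  have "0 \<le> t * (?Q - ?W) + t\<^sup>2 * c" for t
    using min[OF admissible_affine[OF adm q, of t]] c[of t] by linarith
  then show ?thesis
    using quadratic_nonneg_imp_linear_coeff_0 by fastforce
qed

end

lemma energy_eq:
  "energy \<Omega> h u k = (LINT x|lebesgue_on \<Omega>. (u k x - u (k - 1) x)\<^sup>2) / h\<^sup>2 +
     1 / 2 * ((LINT x|lebesgue_on \<Omega>. (norm (grad \<Omega> (u k) x))\<^sup>2) +
              (LINT x|lebesgue_on \<Omega>. (norm (grad \<Omega> (u (k - 1)) x))\<^sup>2))"
  by (simp add: energy_def L2_norm_sq power_divide)

theorem theorem2p1:
  fixes \<Omega> :: "'a::euclidean_space set"
    and u0 v0 :: "'a \<Rightarrow> real"
    and h :: real
    and u :: "nat \<Rightarrow> 'a \<Rightarrow> real"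
  assumes "bounded_lipschitz_domain \<Omega>"
    and "u0 \<in> H1 \<Omega>"
    and "v0 \<in> H1_0 \<Omega>"
    and "h > 0"
    and "u 0 = u0"
    and "u 1 = (\<lambda>x. u0 x + h * v0 x)"
    and "\<And>m. m \<ge> 2 \<Longrightarrow>
      is_arg_min (step_functional \<Omega> h (u (m - 1)) (u (m - 2))) (\<lambda>w. w \<in> admissible \<Omega> u0) (u m)"
  shows "\<forall>j\<ge>1. \<forall>k\<ge>1. energy \<Omega> h u j = energy \<Omega> h u k"
proof -
  have \<Omega>: "open \<Omega>" "bounded \<Omega>"
    using assms(1) by (auto simp: bounded_lipschitz_domain_def)
  have adm: "u m \<in> admissible \<Omega> u0" for m
  proof -
    consider "m = 0" | "m = 1" | "m \<ge> 2" by linarith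
    then show ?thesis
    proof cases
      case 1
      then show ?thesis using admissible_add_H1_0[OF \<Omega> assms(2,3), of 0] assms(5) by simp
    next
      case 2
      then show ?thesis using admissible_add_H1_0[OF \<Omega> assms(2,3), of h] assms(6) by simp
    next
      case 3
      then show ?thesis using assms(7) by (simp add: is_arg_min_def)
    qed
  qed
  \<comment> \<open>Apply the minimization with m = k + 1; the condition \<open>k \<ge> 1\<close> is
    exactly m \<ge> 2, and \<open>p\<close>, \<open>q\<close> become \<open>u k\<close>,
    \<open>u (k - 1)\<close>.\<close>
  have step: "energy \<Omega> h u (Suc k) = energy \<Omega> h u k" if "k \<ge> 1" for k
  proof -
    have "u k \<in> H1 \<Omega>" using adm by (simp add: admissible_def)
    moreover have "is_arg_min (step_functional \<Omega> h (u k) (u (k - 1))) (\<lambda>w. w \<in> admissible \<Omega> u0) (u (Suc k))"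
      using assms(7)[of "Suc k"] that by (simp add: numeral_2_eq_2)
    ultimately show ?thesis
      using energy_step[OF \<Omega> _ adm] by (simp add: energy_eq algebra_simps)
  qed
  have "energy \<Omega> h u k = energy \<Omega> h u 1" if "k \<ge> 1" for k
    using that by (induction k rule: dec_induct) (auto simp: step)
  then show ?thesis by metis
qed

end
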